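(* The spaces $\mathcal{P}(X_n)$ and $\mathcal{P}_-(X_n)$ are monomial (spanned by monomials). Consequently, the monomials $t^s=\prod_{i=1}^n t_i^{s(i)}$, $s\in S(BW_n)$, form a basis of $\mathcal{P}(X_n)$, and the square-free monomials in the variables $t_1,\dots,t_{n-1}$ form a basis of $\mathcal{P}_-(X_n)$.
   Context: Let $\mathbb{K}$ be a field of characteristic $0$. Let $e_1,\dots,e_n$ be the standard basis, $e_0:=0$, $x_{2i-1}=e_i-e_{i-1}$, $x_{2i}=e_i$, and $X_n=(x_1,\dots,x_{2n})$ (a multiset of $2n$ vectors; $x_1=x_2=e_1$). For $x=\sum\lambda_ie_i$ let $p_x=\sum\lambda_it_i\in\mathbb{K}[t_1,\dots,t_n]$ and $p_R=\prod_{x\in R}p_x$. The central $\mathcal{P}$-space is $\mathcal{P}(X_n)=\operatorname{span}\{p_R: R\subseteq X_n,\ X_n\setminus R\text{ has rank }n\}$. With $1_{i,j}=e_i+\dots+e_j$ and $p_{1_{i,j}}(D)=\sum_{k=i}^j\partial/\partial t_k$, the $\mathcal{P}$-internal space $\mathcal{P}_-(X_n)$ is the space of polynomials annihilated by $p_{1_{i,j}}(D)^{j-i+2}$ for $1\le i\le j<n$ and by $p_{1_{i,n}}(D)^{n-i+1}$ for $1\le i\le n$. $BW_n$ is the multigraph on vertices $0,\dots,n$ with two parallel edges $0$–$1$, one edge $0$–$i$ for $2\le i\le n$, and one edge $i$–$(i+1)$ for $1\le i\le n-1$; $d(i,k,j)$ ($1\le i\le k\le j\le n$) is the number of edges joining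 $k$ to a vertex outside $\{i,\dots,j\}$. $S(BW_n)$ is the set of $s\in\mathbb{N}^n$ such that for all $1\le i\le j\le n$ there is $k\in\{i,\dots,j\}$ with $s(k)<d(i,k,j)$. *)

theory Defs
  imports Complex_Main "HOL-Library.Poly_Mapping" "HOL-Library.Multiset"
begin

text \<open>
  Finitely supported functions serve twice: \<open>nat \<Rightarrow>\<^sub>0 'a\<close> for vectors with respect to
  the standard basis, and \<open>(nat \<Rightarrow>\<^sub>0 nat) \<Rightarrow>\<^sub>0 'a\<close> for polynomials in the variables
  \<open>t\<^sub>i\<close>, the keys being the exponent vectors. The dimension \<open>n\<close> is imposed by
  requiring supports to lie in \<open>{1..n}\<close>.
\<close>

type_synonym 'a vector = "nat \<Rightarrow>\<^sub>0 'a"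
type_synonym 'a mpoly = "(nat \<Rightarrow>\<^sub>0 nat) \<Rightarrow>\<^sub>0 'a"

definition pm_scale :: "'a::field \<Rightarrow> ('b \<Rightarrow>\<^sub>0 'a) \<Rightarrow> ('b \<Rightarrow>\<^sub>0 'a)" where
  "pm_scale c = Poly_Mapping.map ((*) c)"

lemma lookup_pm_scale [simp]: "Poly_Mapping.lookup (pm_scale c p) m = c * Poly_Mapping.lookup p m"
  by (simp add: pm_scale_def Poly_Mapping.map.rep_eq when_def)

global_interpretation pm: vector_space "pm_scale :: 'a::field \<Rightarrow> ('b \<Rightarrow>\<^sub>0 'a) \<Rightarrow> ('b \<Rightarrow>\<^sub>0 'a)"
  defines pm_span = pm.span
    and pm_dependent = pm.dependent
    and pm_dim = pm.dim
  by unfold_locales (auto intro!: poly_mapping_eqI simp: lookup_add algebra_simps)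

definition is_basis_of :: "('b \<Rightarrow>\<^sub>0 'a::field) set \<Rightarrow> ('b \<Rightarrow>\<^sub>0 'a) set \<Rightarrow> bool" where
  "is_basis_of B V \<longleftrightarrow> \<not> pm_dependent B \<and> pm_span B = V"

definition exponents :: "nat \<Rightarrow> (nat \<Rightarrow>\<^sub>0 nat) set" where
  "exponents n = {s. Poly_Mapping.keys s \<subseteq> {1..n}}"

definition poly_ring :: "nat \<Rightarrow> 'a::zero mpoly set" where
  "poly_ring n = {p. Poly_Mapping.keys p \<subseteq> exponents n}"

definition tvar :: "nat \<Rightarrow> 'a::field mpoly" where
  "tvar i = Poly_Mapping.single (Poly_Mapping.single i 1) 1"

definition tmon :: "nat \<Rightarrow> (nat \<Rightarrow>\<^sub>0 nat) \<Rightarrow> 'a::field mpoly" where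
  "tmon n s = (\<Prod>i=1..n. tvar i ^ Poly_Mapping.lookup s i)"

definition monomial_space :: "nat \<Rightarrow> 'a::field mpoly set \<Rightarrow> bool" where
  "monomial_space n V \<longleftrightarrow> (\<exists>M \<subseteq> exponents n. V = pm_span (tmon n ` M))"

definition linear_form :: "'a::field vector \<Rightarrow> 'a mpoly" where
  "linear_form x = (\<Sum>i\<in>Poly_Mapping.keys x. pm_scale (Poly_Mapping.lookup x i) (tvar i))"

text \<open>
  In \<open>pdiff\<close>, the truncated subtraction on exponent vectors is harmless: the
  coefficient vanishes whenever \<open>t\<^sub>k\<close> does not divide the monomial.
\<close>

definition pdiff :: "nat \<Rightarrow> 'a::field mpoly \<Rightarrow> 'a mpoly" where
  "pdiff k p = (\<Sum>m\<in>Poly_Mapping.keys p.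
     Poly_Mapping.single (m - Poly_Mapping.single k 1) (of_nat (Poly_Mapping.lookup m k) * Poly_Mapping.lookup p m))"

text \<open>The differential operator obtained from \<open>linear_form x\<close> by substituting \<open>\<partial>/\<partial>t\<^sub>k\<close> for \<open>t\<^sub>k\<close>.\<close>

definition linear_form_D :: "'a::field vector \<Rightarrow> 'a mpoly \<Rightarrow> 'a mpoly" where
  "linear_form_D x p = (\<Sum>k\<in>Poly_Mapping.keys x. pm_scale (Poly_Mapping.lookup x k) (pdiff k p))"

definition evec :: "nat \<Rightarrow> 'a::field vector" where
  "evec i = (if i = 0 then 0 else Poly_Mapping.single i 1)"

text \<open>
  The multiset \<open>X\<^sub>n\<close> is the family \<open>(xvec k)\<close>, \<open>k \<in> {1..2n}\<close>; its sub-multisets are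
  given by subsets of the index set, so that the repeated vector \<open>xvec 1 = xvec 2\<close>
  counts with multiplicity.
\<close>

definition xvec :: "nat \<Rightarrow> 'a::field vector" where
  "xvec k = (if odd k then evec ((k + 1) div 2) - evec ((k + 1) div 2 - 1) else evec (k div 2))"

definition P_central :: "nat \<Rightarrow> 'a::field mpoly set" where
  "P_central n = pm_span {\<Prod>k\<in>R. linear_form (xvec k) | R.
     R \<subseteq> {1..2*n} \<and> pm_dim (xvec ` ({1..2*n} - R) :: 'a vector set) = n}"

definition onevec :: "nat \<Rightarrow> nat \<Rightarrow> 'a::field vector" where
  "onevec i j = (\<Sum>k=i..j. evec k)"

definition P_internal :: "nat \<Rightarrow> 'a::field mpoly set" where
  "P_internal n = {p \<in> poly_ring n.
     (\<forall>i j. 1 \<le> i \<and> i \<le> j \<and> j < n \<longrightarrow> (linear_form_D (onevec i j) ^^ (j - i + 2)) p = 0) \<and>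
     (\<forall>i. 1 \<le> i \<and> i \<le> n \<longrightarrow> (linear_form_D (onevec i n) ^^ (n - i + 1)) p = 0)}"

text \<open>The edges of the multigraph on \<open>{0..n}\<close>, as a multiset of two-element sets.\<close>

definition BW_edges :: "nat \<Rightarrow> nat set multiset" where
  "BW_edges n = {#{0, 1}, {0, 1}#}
     + {#{0, i}. i \<in># mset_set {2..n}#}
     + {#{i, i + 1}. i \<in># mset_set {1..<n}#}"

definition BW_deg_out :: "nat \<Rightarrow> nat \<Rightarrow> nat \<Rightarrow> nat \<Rightarrow> nat" where
  "BW_deg_out n i k j = size {#e \<in># BW_edges n. \<exists>v. v \<notin> {i..j} \<and> e = {k, v}#}"

definition S_BW :: "nat \<Rightarrow> (nat \<Rightarrow>\<^sub>0 nat) set" where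
  "S_BW n = {s \<in> exponents n. \<forall>i j. 1 \<le> i \<and> i \<le> j \<and> j \<le> n \<longrightarrow>
     (\<exists>k\<in>{i..j}. Poly_Mapping.lookup s k < BW_deg_out n i k j)}"

definition squarefree_exponents :: "nat \<Rightarrow> (nat \<Rightarrow>\<^sub>0 nat) set" where
  "squarefree_exponents n = {s. Poly_Mapping.keys s \<subseteq> {1..<n} \<and> (\<forall>i. Poly_Mapping.lookup s i \<le> 1)}"

end

theory Submission
  imports Defs
begin

text \<open>
  Both spaces turn out to consist of all polynomials whose exponent vectors lie in a prescribed
  set. For the internal space, \<open>(\<partial>/\<partial>t\<^sub>i)\<^sup>2\<close> for \<open>i < n\<close> and \<open>\<partial>/\<partial>t\<^sub>n\<close> already force all exponent
  vectors to be square-free in \<open>t\<^sub>1, \<dots>, t\<^sub>n\<^sub>-\<^sub>1\<close>, and the other operators kill such monomials for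
  degree reasons.

  For the central space, \<open>d(i,k,j) = 1 + [k = i] + [k = j < n]\<close>. If the complement of \<open>R\<close> has full
  rank, it contains at least \<open>j - i + 1\<close> of the \<open>2(j - i + 1) + [j < n]\<close> vectors involving the
  coordinates \<open>i, \<dots>, j\<close>; hence \<open>p\<^sub>R\<close> has degree at most \<open>j - i + 1 + [j < n]\<close> in \<open>t\<^sub>i, \<dots>, t\<^sub>j\<close>, and all
  its exponent vectors lie in \<open>S(BW\<^sub>n)\<close>. Conversely, if \<open>f \<in> \<P>(X\<^sub>n)\<close> then \<open>f\<close>, \<open>t\<^sub>n\<^sub>+\<^sub>1 f\<close> and
  \<open>(t\<^sub>n\<^sub>+\<^sub>1 - t\<^sub>n) f\<close>, hence also \<open>t\<^sub>n f\<close>, lie in \<open>\<P>(X\<^sub>n\<^sub>+\<^sub>1)\<close>. Every monomial \<open>t\<^sup>s\<close> with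
  \<open>s \<in> S(BW\<^sub>n\<^sub>+\<^sub>1)\<close> is reached in this way from a monomial of \<open>S(BW\<^sub>n)\<close>: divide by \<open>t\<^sub>n\<^sub>+\<^sub>1\<close> if
  \<open>s(n+1) = 1\<close>, and by \<open>t\<^sub>n\<close> if \<open>s(n+1) = 0 < s(n)\<close>.
\<close>

section \<open>Spans of monomials\<close>

abbreviation mon :: "(nat \<Rightarrow>\<^sub>0 nat) \<Rightarrow> 'a::field mpoly" where
  "mon s \<equiv> Poly_Mapping.single s 1"

lemma pm_subspace_keys: "pm.subspace {p :: 'b \<Rightarrow>\<^sub>0 'a::field. Poly_Mapping.keys p \<subseteq> M}"
  by (rule pm.subspaceI) (auto simp: in_keys_iff lookup_add subset_iff, metis add.right_neutral)

lemma poly_mapping_eq_sum_single: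
  "p = (\<Sum>m\<in>Poly_Mapping.keys p. pm_scale (Poly_Mapping.lookup p m) (Poly_Mapping.single m 1))"
  by (rule poly_mapping_eqI)
     (simp add: lookup_sum lookup_single when_def in_keys_iff if_distrib sum.delta cong: if_cong)

lemma pm_span_mon: "pm_span (mon ` M) = {p :: 'a::field mpoly. Poly_Mapping.keys p \<subseteq> M}"
proof
  show "pm_span (mon ` M) \<subseteq> {p :: 'a mpoly. Poly_Mapping.keys p \<subseteq> M}"
    by (rule pm.span_minimal) (auto simp: pm_subspace_keys)
  show "{p :: 'a mpoly. Poly_Mapping.keys p \<subseteq> M} \<subseteq> pm_span (mon ` M)"
  proof
    fix p :: "'a mpoly" assume "p \<in> {p. Poly_Mapping.keys p \<subseteq> M}"
    then have "(\<Sum>m\<in>Poly_Mapping.keys p. pm_scale (Poly_Mapping.lookup p m) (mon m))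
        \<in> pm_span (mon ` M)"
      by (intro pm.span_sum pm.span_scale pm.span_base) auto
    then show "p \<in> pm_span (mon ` M)"
      using poly_mapping_eq_sum_single [of p] by simp
  qed
qed

lemma inj_mon: "inj (mon :: _ \<Rightarrow> 'a::field mpoly)"
proof (rule injI)
  fix s t :: "nat \<Rightarrow>\<^sub>0 nat" assume "(mon s :: 'a mpoly) = mon t"
  then have "Poly_Mapping.keys (mon s :: 'a mpoly) = Poly_Mapping.keys (mon t :: 'a mpoly)" by simp
  then show "s = t" by simp
qed

text \<open>A dependence would put some \<open>mon s\<close> into the span of the other monomials,
  but no polynomial in that span has \<open>s\<close> among its keys.\<close>

lemma independent_mon: "\<not> pm_dependent (mon ` M :: 'a::field mpoly set)"
proof
  assume "pm_dependent (mon ` M :: 'a mpoly set)"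
  then obtain s where "s \<in> M" "(mon s :: 'a mpoly) \<in> pm_span (mon ` M - {mon s})"
    unfolding pm.dependent_def by blast
  moreover have "mon ` M - {mon s} = (mon ` (M - {s}) :: 'a mpoly set)"
    using inj_mon by (auto simp: inj_def)
  ultimately show False by (simp add: pm_span_mon)
qed

lemma prod_single:
  "(\<Prod>i\<in>A. Poly_Mapping.single (f i) (1::'a::field)) = Poly_Mapping.single (\<Sum>i\<in>A. f i) 1"
  for f :: "'c \<Rightarrow> nat \<Rightarrow>\<^sub>0 nat"
  by (induction A rule: infinite_finite_induct) (simp_all add: mult_single)

lemma tvar_power: "tvar i ^ k = (mon (Poly_Mapping.single i k) :: 'a::field mpoly)"
  unfolding tvar_def
  by (induction k) (simp_all add: mult_single flip: single_add)

lemma tmon_eq_mon: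
  assumes "s \<in> exponents n"
  shows "tmon n s = (mon s :: 'a::field mpoly)"
proof -
  have "(\<Sum>i=1..n. Poly_Mapping.single i (Poly_Mapping.lookup s i)) = s"
    using assms
    by (intro poly_mapping_eqI)
       (auto simp: exponents_def lookup_sum lookup_single when_def in_keys_iff subset_iff)
  then show ?thesis by (simp add: tmon_def tvar_power prod_single)
qed

text \<open>Reduces the whole theorem to describing each space by the exponents it allows.
  Injectivity is recorded because a basis given as an image set does not show that distinct
  exponents give distinct members.\<close>

lemma monomial_basis:
  fixes V :: "'a::field mpoly set"
  assumes "M \<subseteq> exponents n" "V = {p. Poly_Mapping.keys p \<subseteq> M}"
  shows "monomial_space n V \<and> is_basis_of (tmon n ` M) V \<and> inj_on (tmon n :: _ \<Rightarrow> 'a mpoly) M"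
proof -
  have "tmon n ` M = (mon ` M :: 'a mpoly set)"
    using assms(1) by (intro image_cong) (auto simp: tmon_eq_mon)
  moreover have "inj_on (tmon n :: _ \<Rightarrow> 'a mpoly) M \<longleftrightarrow> inj_on (mon :: _ \<Rightarrow> 'a mpoly) M"
    using assms(1) by (intro inj_on_cong) (auto simp: tmon_eq_mon)
  moreover have "inj_on (mon :: _ \<Rightarrow> 'a mpoly) M"
    using inj_mon by (rule inj_on_subset) simp
  ultimately show ?thesis
    using assms independent_mon[of M] pm_span_mon[of M]
    by (auto simp: monomial_space_def is_basis_of_def intro!: exI[of _ M])
qed

section \<open>Exponents occurring in products of polynomials\<close>

lemma keys_prod_weight_le:
  fixes f :: "'c \<Rightarrow> 'a::field mpoly" and d :: "'c \<Rightarrow> nat"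
  assumes "finite R" and "\<And>k m. k \<in> R \<Longrightarrow> m \<in> Poly_Mapping.keys (f k) \<Longrightarrow> (\<Sum>l\<in>J. Poly_Mapping.lookup m l) \<le> d k"
    and "m \<in> Poly_Mapping.keys (\<Prod>k\<in>R. f k)"
  shows "(\<Sum>l\<in>J. Poly_Mapping.lookup m l) \<le> (\<Sum>k\<in>R. d k)"
  using assms
proof (induction R arbitrary: m rule: finite_induct)
  case (insert k R)
  then obtain a b where "m = a + b" "a \<in> Poly_Mapping.keys (f k)" "b \<in> Poly_Mapping.keys (\<Prod>k\<in>R. f k)"
    using keys_mult[of "f k" "\<Prod>k\<in>R. f k"] by auto
  moreover from this have "(\<Sum>l\<in>J. Poly_Mapping.lookup b l) \<le> (\<Sum>k\<in>R. d k)"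
    using insert by blast
  moreover have "(\<Sum>l\<in>J. Poly_Mapping.lookup a l) \<le> d k"
    using insert.prems calculation by blast
  ultimately show ?case using insert.hyps by (simp add: lookup_add sum.distrib)
qed simp

lemma keys_prod_exponents:
  fixes f :: "'c \<Rightarrow> 'a::field mpoly"
  assumes "finite R" and "\<And>k. k \<in> R \<Longrightarrow> Poly_Mapping.keys (f k) \<subseteq> exponents n"
  shows "Poly_Mapping.keys (\<Prod>k\<in>R. f k) \<subseteq> exponents n"
  using assms
proof (induction R rule: finite_induct)
  case (insert k R)
  have "a + b \<in> exponents n" if "a \<in> exponents n" "b \<in> exponents n" for a b
    using that keys_add[of a b] by (auto simp: exponents_def)
  then have "{a + b | a b. a \<in> Poly_Mapping.keys (f k) \<and> b \<in> Poly_Mapping.keys (\<Prod>k\<in>R. f k)} \<subseteq> exponents n"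
    using insert by blast
  then show ?case
    using insert.hyps keys_mult[of "f k" "\<Prod>k\<in>R. f k"] by simp
qed (simp add: exponents_def)

section \<open>The internal space\<close>

lemma lookup_pdiff:
  "Poly_Mapping.lookup (pdiff k p) m =
    of_nat (Suc (Poly_Mapping.lookup m k)) * Poly_Mapping.lookup p (m + Poly_Mapping.single k 1)"
  for p :: "'a::field mpoly"
proof -
  let ?e = "Poly_Mapping.single k (1::nat)"
  let ?c = "\<lambda>m'. of_nat (Poly_Mapping.lookup m' k) * Poly_Mapping.lookup p m'"
  \<comment> \<open>Truncated subtraction fixes every \<open>m'\<close> not involving
    \<open>k\<close>, so such an \<open>m'\<close> may also be sent to \<open>m\<close>; its
    coefficient \<open>?c m'\<close> is 0, and only \<open>m + ?e\<close> contributes.\<close>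
  have *: "(?c m' when m' - ?e = m) = (if m' = m + ?e then ?c m' else 0)" for m'
  proof (cases "Poly_Mapping.lookup m' k = 0")
    case False
    then have "m' - ?e + ?e = m'"
      by (intro poly_mapping_eqI) (auto simp: lookup_add lookup_minus lookup_single when_def)
    then have "m' - ?e = m \<longleftrightarrow> m' = m + ?e" by auto
    then show ?thesis by (simp add: when_def)
  qed (auto simp: when_def lookup_add)
  show ?thesis
    by (simp only: pdiff_def lookup_sum lookup_single *)
       (simp add: in_keys_iff lookup_add sum.delta)
qed

lemma keys_linear_form_D:
  assumes "m \<in> Poly_Mapping.keys (linear_form_D x p)"
  obtains k where "k \<in> Poly_Mapping.keys x" "m + Poly_Mapping.single k 1 \<in> Poly_Mapping.keys p"
proof -
  have "(\<Sum>k\<in>Poly_Mapping.keys x. Poly_Mapping.lookup x k * Poly_Mapping.lookup (pdiff k p) m) \<noteq> 0"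
    using assms by (simp add: in_keys_iff linear_form_D_def lookup_sum)
  then obtain k where "k \<in> Poly_Mapping.keys x" "Poly_Mapping.lookup (pdiff k p) m \<noteq> 0"
    by (metis (no_types, lifting) mult_zero_right sum.neutral)
  then show ?thesis using that by (auto simp: lookup_pdiff in_keys_iff)
qed

text \<open>Each application lowers the degree in the variables of \<open>J\<close> by one. After
  \<open>N\<close> applications every remaining key would have degree below 0, so there is
  none.\<close>

lemma linear_form_D_pow_eq_0:
  assumes "finite J" "Poly_Mapping.keys x \<subseteq> J"
    and "\<And>m. m \<in> Poly_Mapping.keys p \<Longrightarrow> (\<Sum>l\<in>J. Poly_Mapping.lookup m l) < N"
  shows "(linear_form_D x ^^ N) p = 0"
  using assms(3)
proof (induction N arbitrary: p)
  case 0
  then show ?case by (metis ex_in_conv keys_eq_empty funpow_0 not_less_zero)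
next
  case (Suc N)
  have "(\<Sum>l\<in>J. Poly_Mapping.lookup m l) < N" if m: "m \<in> Poly_Mapping.keys (linear_form_D x p)" for m
  proof -
    obtain k where k: "k \<in> Poly_Mapping.keys x" "m + Poly_Mapping.single k 1 \<in> Poly_Mapping.keys p"
      using keys_linear_form_D[OF m] by blast
    then have "(\<Sum>l\<in>J. Poly_Mapping.lookup (m + Poly_Mapping.single k 1) l) < Suc N"
      using Suc.prems by blast
    moreover have "(\<Sum>l\<in>J. Poly_Mapping.lookup (Poly_Mapping.single k (1::nat)) l) = 1"
      using k assms(1,2) by (auto simp: lookup_single when_def)
    ultimately show ?thesis by (simp add: lookup_add sum.distrib)
  qed
  then show ?case using Suc.IH by (simp add: funpow_swap1)
qed

lemma keys_evec: "Poly_Mapping.keys (evec k :: 'a::field vector) = (if k = 0 then {} else {k})"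
  by (simp add: evec_def)

lemma keys_onevec: "Poly_Mapping.keys (onevec i j :: 'a::field vector) \<subseteq> {i..j}"
proof -
  have "Poly_Mapping.lookup (onevec i j :: 'a vector) l = 0" if "l \<notin> {i..j}" for l
    using that by (auto simp: onevec_def lookup_sum evec_def lookup_single when_def intro!: sum.neutral)
  then show ?thesis by (force simp: in_keys_iff)
qed

lemma linear_form_D_onevec_self:
  "1 \<le> i \<Longrightarrow> linear_form_D (onevec i i) = (pdiff i :: 'a::field mpoly \<Rightarrow> _)"
  by (rule ext, rule poly_mapping_eqI) (simp add: linear_form_D_def onevec_def evec_def)

lemma P_internal_eq:
  assumes "n \<ge> 1"
  shows "P_internal n = {p :: 'a::field_char_0 mpoly. Poly_Mapping.keys p \<subseteq> squarefree_exponents n}"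
proof
  show "P_internal n \<subseteq> {p :: 'a mpoly. Poly_Mapping.keys p \<subseteq> squarefree_exponents n}"
  proof safe
    fix p :: "'a mpoly" and s assume p: "p \<in> P_internal n" and s: "s \<in> Poly_Mapping.keys p"
    have less: "Poly_Mapping.lookup s i \<le> 1" if "1 \<le> i" "i < n" for i
    proof (rule ccontr)
      let ?e = "Poly_Mapping.single i (1::nat)"
      assume "\<not> ?thesis"
      \<comment> \<open>The truncated subtractions can be undone because the exponent at
        \<open>i\<close> is at least 2.\<close>
      then have "s = s - ?e - ?e + ?e + ?e"
        by (intro poly_mapping_eqI) (auto simp: lookup_add lookup_minus lookup_single when_def)
      then have nz: "Poly_Mapping.lookup p (s - ?e - ?e + ?e + ?e) \<noteq> 0"
        using s by (simp add: in_keys_iff)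
      have "(linear_form_D (onevec i i) ^^ (i - i + 2)) p = 0"
        using p that unfolding P_internal_def by blast
      then have "pdiff i (pdiff i p) = 0"
        using that by (simp add: linear_form_D_onevec_self numeral_2_eq_2)
      then have "Poly_Mapping.lookup (pdiff i (pdiff i p)) (s - ?e - ?e) = 0" by simp
      \<comment> \<open>This coefficient is the one of \<open>s\<close> in \<open>p\<close> times
        two positive integers, which are nonzero in characteristic 0.\<close>
      then show False using nz unfolding lookup_pdiff
        by (simp del: of_nat_Suc)
    qed
    have last: "Poly_Mapping.lookup s n = 0"
    proof (rule ccontr)
      let ?e = "Poly_Mapping.single n (1::nat)"
      assume "\<not> ?thesis"
      then have "s = s - ?e + ?e"
        by (intro poly_mapping_eqI) (auto simp: lookup_add lookup_minus lookup_single when_def)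
      then have nz: "Poly_Mapping.lookup p (s - ?e + ?e) \<noteq> 0"
        using s by (simp add: in_keys_iff)
      have "(linear_form_D (onevec n n) ^^ (n - n + 1)) p = 0"
        using p assms unfolding P_internal_def by blast
      then have "pdiff n p = 0"
        using assms by (simp add: linear_form_D_onevec_self)
      then have "Poly_Mapping.lookup (pdiff n p) (s - ?e) = 0" by simp
      then show False using nz unfolding lookup_pdiff
        by (simp del: of_nat_Suc)
    qed
    have sub: "Poly_Mapping.keys s \<subseteq> {1..n}"
      using p s by (auto simp: P_internal_def poly_ring_def exponents_def)
    have "Poly_Mapping.keys s \<subseteq> {1..<n}"
    proof
      fix i assume i: "i \<in> Poly_Mapping.keys s"
      with last have "i \<noteq> n" by (auto simp: in_keys_iff)
      with subsetD[OF sub i] show "i \<in> {1..<n}" by simp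
    qed
    moreover have "Poly_Mapping.lookup s i \<le> 1" for i
    proof (cases "i \<in> Poly_Mapping.keys s")
      case True
      with calculation less[of i] show ?thesis by auto
    qed (simp add: in_keys_iff)
    ultimately show "s \<in> squarefree_exponents n"
      by (simp add: squarefree_exponents_def)
  qed
  show "{p :: 'a mpoly. Poly_Mapping.keys p \<subseteq> squarefree_exponents n} \<subseteq> P_internal n"
  proof
    fix p :: "'a mpoly" assume "p \<in> {p. Poly_Mapping.keys p \<subseteq> squarefree_exponents n}"
    then have p: "m \<in> squarefree_exponents n" if "m \<in> Poly_Mapping.keys p" for m
      using that by auto
    have deg: "(\<Sum>l\<in>{i..j}. Poly_Mapping.lookup m l) \<le> card ({i..j} \<inter> {1..<n})"
      if m: "m \<in> Poly_Mapping.keys p" for m i j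
    proof -
      have "Poly_Mapping.lookup m l \<le> of_bool (l \<in> {1..<n})" for l
        using p[OF m] by (auto simp: squarefree_exponents_def in_keys_iff subset_iff)
      then have "(\<Sum>l\<in>{i..j}. Poly_Mapping.lookup m l) \<le> (\<Sum>l\<in>{i..j}. of_bool (l \<in> {1..<n}))"
        by (intro sum_mono)
      also have "\<dots> = card ({i..j} \<inter> {1..<n})"
        by (simp add: Int_def)
      finally show ?thesis .
    qed
    have "p \<in> poly_ring n"
      using p by (fastforce simp: poly_ring_def squarefree_exponents_def exponents_def)
    moreover have "(linear_form_D (onevec i j) ^^ (j - i + 2)) p = 0" if "1 \<le> i" "i \<le> j" for i j
    proof (rule linear_form_D_pow_eq_0[of "{i..j}"])
      fix m assume "m \<in> Poly_Mapping.keys p"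
      note deg[OF this, of i j]
      also have "card ({i..j} \<inter> {1..<n}) \<le> card {i..j}" by (intro card_mono) auto
      also have "\<dots> < j - i + 2" using that by simp
      finally show "(\<Sum>l\<in>{i..j}. Poly_Mapping.lookup m l) < j - i + 2" .
    qed (auto intro: keys_onevec[THEN subsetD])
    moreover have "(linear_form_D (onevec i n) ^^ (n - i + 1)) p = 0" if "1 \<le> i" "i \<le> n" for i
    proof (rule linear_form_D_pow_eq_0[of "{i..n}"])
      fix m assume "m \<in> Poly_Mapping.keys p"
      note deg[OF this, of i n]
      \<comment> \<open>The variable with index \<open>n\<close> does not occur, which makes the
        exponent smaller by one sufficient for intervals ending at \<open>n\<close>.\<close>
      also have "card ({i..n} \<inter> {1..<n}) \<le> card {i..<n}" by (intro card_mono) auto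
      also have "\<dots> < n - i + 1" by simp
      finally show "(\<Sum>l\<in>{i..n}. Poly_Mapping.lookup m l) < n - i + 1" .
    qed (auto intro: keys_onevec[THEN subsetD])
    ultimately show "p \<in> P_internal n" by (simp add: P_internal_def)
  qed
qed

section \<open>Parking functions of the fan\<close>

text \<open>The edge from \<open>k\<close> to 0 always leaves the interval. The edge to
  \<open>k - 1\<close> leaves it only for \<open>k = i\<close>; for \<open>k = 1\<close> its role is
  taken by the second edge to 0. The edge to \<open>k + 1\<close> leaves it only for
  \<open>k = j\<close>, and exists only below \<open>n\<close>.\<close>

lemma BW_deg_out_eq:
  assumes "1 \<le> i" "i \<le> k" "k \<le> j" "j \<le> n"
  shows "BW_deg_out n i k j = 1 + of_bool (k = i) + of_bool (k = j \<and> j < n)"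
proof -
  define P where "P = (\<lambda>e. \<exists>v. v \<notin> {i..j} \<and> e = {k, v})"
  have P: "P {a, b} \<longleftrightarrow> a = k \<and> b \<notin> {i..j} \<or> b = k \<and> a \<notin> {i..j}" for a b
    by (auto simp: P_def doubleton_eq_iff)
  have img: "size (filter_mset P {#f x. x \<in># mset_set A#}) = card {x \<in> A. P (f x)}"
    if "finite A" for f :: "nat \<Rightarrow> nat set" and A
    using that by (simp add: filter_mset_image_mset filter_mset_mset_set)
  have 1: "size (filter_mset P {#{0, 1}, {0, 1}#}) = 2 * of_bool (k = 1)"
    using assms by (simp add: P)
  have "{l \<in> {2..n}. P {0, l}} = (if k \<ge> 2 then {k} else {})"
    using assms by (auto simp: P)
  then have 2: "card {l \<in> {2..n}. P {0, l}} = of_bool (k \<ge> 2)" by simp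
  have "{l \<in> {1..<n}. P {l, l + 1}} = {l. k = i \<and> k \<ge> 2 \<and> l = k - 1} \<union> {l. k = j \<and> j < n \<and> l = k}"
    using assms unfolding P by auto
  moreover have "card \<dots> = card {l. k = i \<and> k \<ge> 2 \<and> l = k - 1} + card {l. k = j \<and> j < n \<and> l = k}"
    by (rule card_Un_disjoint) auto
  ultimately have 3: "card {l \<in> {1..<n}. P {l, l + 1}} = of_bool (k = i \<and> k \<ge> 2) + of_bool (k = j \<and> j < n)"
    by simp
  have "BW_deg_out n i k j = size (filter_mset P (BW_edges n))"
    by (simp add: BW_deg_out_def P_def)
  also have "\<dots> = 2 * of_bool (k = 1) + of_bool (k \<ge> 2)
      + (of_bool (k = i \<and> k \<ge> 2) + of_bool (k = j \<and> j < n))"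
    unfolding BW_edges_def filter_union_mset size_union img[OF finite_atLeastAtMost]
      img[OF finite_atLeastLessThan] 1 2 3 ..
  also have "\<dots> = 1 + of_bool (k = i) + of_bool (k = j \<and> j < n)"
    using assms by (cases "k = 1") auto
  finally show ?thesis .
qed

lemma S_BW_eq:
  "S_BW n = {s \<in> exponents n. \<forall>i j. 1 \<le> i \<and> i \<le> j \<and> j \<le> n \<longrightarrow>
     (\<exists>k\<in>{i..j}. Poly_Mapping.lookup s k < 1 + of_bool (k = i) + of_bool (k = j \<and> j < n))}"
  unfolding S_BW_def
  by (intro Collect_cong conj_cong refl all_cong bex_cong) (simp add: BW_deg_out_eq)

text \<open>If every index of an interval reached its threshold, the exponents would sum to at least
  \<open>j - i + 2 + of_bool (j < n)\<close>, the total of the thresholds, which is one more than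
  allowed.\<close>

lemma S_BW_I:
  assumes "s \<in> exponents n"
    and le: "\<And>i j. 1 \<le> i \<Longrightarrow> i \<le> j \<Longrightarrow> j \<le> n \<Longrightarrow>
      (\<Sum>k\<in>{i..j}. Poly_Mapping.lookup s k) \<le> j - i + 1 + of_bool (j < n)"
  shows "s \<in> S_BW n"
proof (rule ccontr)
  assume "s \<notin> S_BW n"
  then obtain i j where ij: "1 \<le> i" "i \<le> j" "j \<le> n"
    and ge: "\<forall>k\<in>{i..j}. 1 + of_bool (k = i) + of_bool (k = j \<and> j < n) \<le> Poly_Mapping.lookup s k"
    using assms(1) by (auto simp: S_BW_eq not_less)
  have "(\<Sum>k\<in>{i..j}. 1 + of_bool (k = i) + of_bool (k = j \<and> j < n)) \<le> (\<Sum>k\<in>{i..j}. Poly_Mapping.lookup s k)"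
    using ge by (intro sum_mono) auto
  moreover have "(\<Sum>k\<in>{i..j}. of_bool (k = i)) = (1 :: nat)"
    "(\<Sum>k\<in>{i..j}. of_bool (k = j \<and> j < n)) = (of_bool (j < n) :: nat)"
    using ij by (cases "j < n"; simp add: of_bool_def)+
  then have "(\<Sum>k\<in>{i..j}. 1 + of_bool (k = i) + of_bool (k = j \<and> j < n)) = j - i + 2 + of_bool (j < n)"
    using ij unfolding sum.distrib by simp
  ultimately show False using le[OF ij] by simp
qed

text \<open>For intervals inside \<open>{1..n}\<close>, passing from \<open>n\<close> to
  \<open>Suc n\<close> changes one thing: an interval ending at \<open>n\<close> now grants its
  endpoint one extra unit. Each case shows how this unit can be given up again.\<close>

lemma S_BW_Suc_cases:
  assumes "s \<in> S_BW (Suc n)"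
  obtains s' where "s' \<in> S_BW n" "s = s' + Poly_Mapping.single (Suc n) 1"
    | "s \<in> S_BW n"
    | s' where "n \<ge> 1" "s' \<in> S_BW n" "s = s' + Poly_Mapping.single n 1"
proof -
  have ex: "s \<in> exponents (Suc n)"
    and S: "\<And>i j. 1 \<le> i \<Longrightarrow> i \<le> j \<Longrightarrow> j \<le> Suc n \<Longrightarrow>
      \<exists>k\<in>{i..j}. Poly_Mapping.lookup s k < 1 + of_bool (k = i) + of_bool (k = j \<and> j < Suc n)"
    using assms unfolding S_BW_eq by auto
  \<comment> \<open>The interval consisting of \<open>Suc n\<close> alone has threshold 2: the last
    vertex has no edge to a successor.\<close>
  consider "Poly_Mapping.lookup s (Suc n) = 1" | "Poly_Mapping.lookup s (Suc n) = 0"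
    using S[of "Suc n" "Suc n"] by fastforce
  then show ?thesis
  proof cases
    case 1
    define s' where "s' = s - Poly_Mapping.single (Suc n) 1"
    have l: "Poly_Mapping.lookup s' k = (if k = Suc n then 0 else Poly_Mapping.lookup s k)" for k
      using 1 by (simp add: s'_def lookup_minus lookup_single)
    have "s = s' + Poly_Mapping.single (Suc n) 1"
      by (rule poly_mapping_eqI) (use 1 in \<open>auto simp: l lookup_add lookup_single when_def\<close>)
    moreover have "s' \<in> exponents n"
      using ex by (auto simp: exponents_def in_keys_iff subset_iff l le_Suc_eq)
    moreover have "\<exists>k\<in>{i..j}. Poly_Mapping.lookup s' k < 1 + of_bool (k = i) + of_bool (k = j \<and> j < n)"
      if ij: "1 \<le> i" "i \<le> j" "j \<le> n" for i j
    proof (cases "j = n")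
      case True
      \<comment> \<open>Extending the interval to \<open>Suc n\<close> removes the extra unit at
        \<open>n\<close>. The new endpoint cannot be the witness, since its exponent 1 equals its
        threshold.\<close>
      obtain k where "k \<in> {i..Suc n}" "Poly_Mapping.lookup s k < 1 + of_bool (k = i)"
        using S[of i "Suc n"] ij by auto
      moreover from this have "k \<noteq> Suc n" using 1 ij by auto
      ultimately show ?thesis using True by (intro bexI[of _ k]) (auto simp: l)
    next
      case False
      with ij S[of i j] show ?thesis by (auto simp: l)
    qed
    ultimately show ?thesis by (intro that(1)[of s']) (simp_all add: S_BW_eq)
  next
    case 2
    then have "Suc n \<notin> Poly_Mapping.keys s" by (simp add: in_keys_iff)
    then have ex': "s \<in> exponents n"
      using ex by (simp add: exponents_def atLeastAtMostSuc_conv subset_insert)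
    show ?thesis
    proof (cases "Poly_Mapping.lookup s n = 0")
      case True
      have "\<exists>k\<in>{i..j}. Poly_Mapping.lookup s k < 1 + of_bool (k = i) + of_bool (k = j \<and> j < n)"
        if "1 \<le> i" "i \<le> j" "j \<le> n" for i j
      proof (cases "j = n")
        case False
        with that S[of i j] show ?thesis by auto
      next
        case j: True
        \<comment> \<open>The exponent 0 at \<open>n\<close> lies below every threshold.\<close>
        with True that show ?thesis by (intro bexI[of _ n]) auto
      qed
      then show ?thesis using that(2) ex' by (simp add: S_BW_eq)
    next
      case False
      define s' where "s' = s - Poly_Mapping.single n 1"
      have l: "Poly_Mapping.lookup s' k = (if k = n then Poly_Mapping.lookup s n - 1 else Poly_Mapping.lookup s k)" for k
        by (simp add: s'_def lookup_minus lookup_single)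
      have "n \<ge> 1"
        using False ex' by (auto simp: exponents_def in_keys_iff subset_iff)
      moreover have "s = s' + Poly_Mapping.single n 1"
        by (rule poly_mapping_eqI) (use False in \<open>auto simp: l lookup_add lookup_single when_def\<close>)
      moreover have "s' \<in> exponents n"
        using ex' by (auto simp: exponents_def in_keys_iff subset_iff l split: if_splits)
      moreover have "\<exists>k\<in>{i..j}. Poly_Mapping.lookup s' k < 1 + of_bool (k = i) + of_bool (k = j \<and> j < n)"
        if ij: "1 \<le> i" "i \<le> j" "j \<le> n" for i j
      proof -
        \<comment> \<open>The same witness serves for \<open>s'\<close>: if it is \<open>n\<close>,
          the lost unit is matched by the lowered exponent.\<close>
        obtain k where "k \<in> {i..j}" "Poly_Mapping.lookup s k < 1 + of_bool (k = i) + of_bool (k = j)"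
          using S[of i j] ij by auto
        then show ?thesis
          using False ij by (intro bexI[of _ k]) (auto simp: l)
      qed
      ultimately show ?thesis by (intro that(3)[of s']) (simp_all add: S_BW_eq)
    qed
  qed
qed

section \<open>The central space\<close>

lemma keys_linear_form:
  "Poly_Mapping.keys (linear_form x :: 'a::field mpoly)
    \<subseteq> (\<lambda>i. Poly_Mapping.single i 1) ` Poly_Mapping.keys x"
proof
  fix m assume "m \<in> Poly_Mapping.keys (linear_form x :: 'a mpoly)"
  then have "(\<Sum>i\<in>Poly_Mapping.keys x. Poly_Mapping.lookup x i * Poly_Mapping.lookup (tvar i) m) \<noteq> 0"
    by (simp add: linear_form_def in_keys_iff lookup_sum)
  then obtain i where "i \<in> Poly_Mapping.keys x" "Poly_Mapping.lookup (tvar i :: 'a mpoly) m \<noteq> 0"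
    by (metis (no_types, lifting) mult_zero_right sum.neutral)
  then show "m \<in> (\<lambda>i. Poly_Mapping.single i 1) ` Poly_Mapping.keys x"
    by (auto simp: tvar_def lookup_single when_def split: if_splits)
qed

lemma xvec_even: "xvec (2 * i) = (evec i :: 'a::field vector)"
  by (simp add: xvec_def)

lemma xvec_odd: "xvec (Suc (2 * i)) = (evec (Suc i) - evec i :: 'a::field vector)"
  by (simp add: xvec_def)

text \<open>Source of the index window \<open>{2 * i - 1..2 * j + 1}\<close> used below: all vectors
  involving a coordinate from \<open>{i..j}\<close> have their index in it.\<close>

lemma keys_xvec:
  assumes "l \<in> Poly_Mapping.keys (xvec k :: 'a::field vector)"
  shows "1 \<le> l" "k \<in> {2 * l - 1..2 * l + 1}"
proof -
  have "l \<noteq> 0 \<and> (if odd k then l = (k + 1) div 2 \<or> l = (k + 1) div 2 - 1 else l = k div 2)"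
    using assms keys_diff[of "evec ((k + 1) div 2) :: 'a vector" "evec ((k + 1) div 2 - 1)"]
    unfolding xvec_def by (auto simp: keys_evec split: if_splits)
  then show "1 \<le> l" "k \<in> {2 * l - 1..2 * l + 1}"
    by (auto elim!: oddE evenE split: if_splits)
qed

lemma keys_xvec_le:
  assumes "k \<in> {1..2*n}"
  shows "Poly_Mapping.keys (xvec k :: 'a::field vector) \<subseteq> {1..n}"
proof
  fix l assume "l \<in> Poly_Mapping.keys (xvec k :: 'a vector)"
  from keys_xvec[OF this] assms show "l \<in> {1..n}" by auto
qed

lemma linear_form_evec: "linear_form (evec i) = (if i = 0 then 0 else tvar i :: 'a::field mpoly)"
  by (simp add: linear_form_def evec_def)

lemma linear_form_xvec_odd:
  "linear_form (xvec (Suc (2 * i))) = (tvar (Suc i) - linear_form (evec i) :: 'a::field mpoly)"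
proof (cases "i = 0")
  case True
  then have "xvec (Suc (2 * i)) = (evec (Suc i) :: 'a vector)"
    by (simp only: xvec_odd) (simp add: evec_def)
  then show ?thesis using True by (simp only: linear_form_evec) simp
next
  case False
  then have l: "Poly_Mapping.lookup (xvec (Suc (2 * i)) :: 'a vector) k = (if k = Suc i then 1 else if k = i then - 1 else 0)" for k
    by (auto simp: xvec_odd evec_def lookup_minus lookup_single when_def)
  then have "Poly_Mapping.keys (xvec (Suc (2 * i)) :: 'a vector) = {Suc i, i}"
    by (auto simp: in_keys_iff split: if_splits)
  then have "linear_form (xvec (Suc (2 * i)) :: 'a vector) = pm_scale 1 (tvar (Suc i)) + pm_scale (-1) (tvar i)"
    unfolding linear_form_def by (simp add: l)
  with False show ?thesis by (simp add: linear_form_evec)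
qed

section \<open>Full rank and the standard basis\<close>

lemma pm_span_evec:
  assumes "0 \<notin> A" "Poly_Mapping.keys x \<subseteq> A"
  shows "x \<in> pm_span (evec ` A :: 'a::field vector set)"
proof -
  have "Poly_Mapping.single k 1 \<in> (evec ` A :: 'a vector set)" if "k \<in> Poly_Mapping.keys x" for k
  proof (rule image_eqI)
    from that assms show "k \<in> A" by blast
    with assms(1) have "k \<noteq> 0" by metis
    then show "Poly_Mapping.single k 1 = (evec k :: 'a vector)" by (simp add: evec_def)
  qed
  then have "(\<Sum>k\<in>Poly_Mapping.keys x. pm_scale (Poly_Mapping.lookup x k) (Poly_Mapping.single k 1))
      \<in> pm_span (evec ` A)"
    by (intro pm.span_sum pm.span_scale pm.span_base)
  then show ?thesis using poly_mapping_eq_sum_single[of x] by simp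
qed

lemma xvec_in_span_evec:
  assumes "k \<in> {1..2*n}"
  shows "(xvec k :: 'a::field vector) \<in> pm_span (evec ` {1..n})"
  by (rule pm_span_evec) (use keys_xvec_le[OF assms] in auto)

lemma independent_evec: "\<not> pm_dependent (evec ` {1..n} :: 'a::field vector set)"
proof
  assume "pm_dependent (evec ` {1..n} :: 'a vector set)"
  then obtain i where i: "i \<in> {1..n}" and "(evec i :: 'a vector) \<in> pm_span (evec ` {1..n} - {evec i})"
    unfolding pm.dependent_def by blast
  moreover have "pm_span (evec ` {1..n} - {evec i}) \<subseteq> {p :: 'a vector. Poly_Mapping.keys p \<subseteq> - {i}}"
    by (rule pm.span_minimal[OF _ pm_subspace_keys]) (auto simp: keys_evec split: if_splits)
  ultimately show False by (auto simp: keys_evec)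
qed

lemma inj_on_evec: "inj_on (evec :: nat \<Rightarrow> 'a::field vector) {1..n}"
proof (rule inj_onI)
  fix i j assume "i \<in> {1..n}" "j \<in> {1..n}" "(evec i :: 'a vector) = evec j"
  then have "Poly_Mapping.keys (evec i :: 'a vector) = Poly_Mapping.keys (evec j :: 'a vector)" by simp
  with \<open>i \<in> {1..n}\<close> \<open>j \<in> {1..n}\<close> show "i = j" by (simp add: keys_evec)
qed

lemma pm_dim_xvec_eqI:
  assumes "C \<subseteq> {1..2*n}" "evec ` {1..n} \<subseteq> pm_span (xvec ` C :: 'a::field vector set)"
  shows "pm_dim (xvec ` C :: 'a vector set) = n"
proof -
  have "xvec ` C \<subseteq> pm_span (evec ` {1..n} :: 'a vector set)"
    using assms(1) xvec_in_span_evec by blast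
  then have "pm_span (evec ` {1..n}) = pm_span (xvec ` C :: 'a vector set)"
    using assms(2) by (simp add: pm.span_eq)
  then have "pm_dim (xvec ` C :: 'a vector set) = card (evec ` {1..n} :: 'a vector set)"
    using independent_evec by (rule pm.dim_eq_card)
  then show ?thesis using card_image[OF inj_on_evec, of n] by simp
qed

text \<open>A maximal independent subset of the family has \<open>n\<close> elements. A unit vector
  outside its span could be added, giving \<open>n + 1\<close> independent vectors in a space
  spanned by \<open>n\<close>.\<close>

lemma evec_subset_span_xvec:
  assumes "C \<subseteq> {1..2*n}" "pm_dim (xvec ` C :: 'a::field vector set) = n"
  shows "evec ` {1..n} \<subseteq> pm_span (xvec ` C :: 'a vector set)"
proof -
  obtain B :: "'a vector set" where B: "B \<subseteq> xvec ` C" "\<not> pm_dependent B" "xvec ` C \<subseteq> pm_span B"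
      "card B = pm_dim (xvec ` C :: 'a vector set)"
    by (rule pm.basis_exists)
  \<comment> \<open>Finiteness is part of the claim because \<open>card\<close> is 0 on infinite
    sets.\<close>
  have card_le: "finite D \<and> card D \<le> n"
    if "\<not> pm_dependent D" "D \<subseteq> pm_span (evec ` {1..n})" for D :: "'a vector set"
    using pm.independent_span_bound[of "evec ` {1..n}" D] that
    by (simp only: card_image[OF inj_on_evec] card_atLeastAtMost) simp
  have sub: "B \<subseteq> pm_span (evec ` {1..n})"
    using B(1) assms(1) xvec_in_span_evec by blast
  have "evec ` {1..n} \<subseteq> pm_span B"
  proof (rule ccontr)
    assume "\<not> ?thesis"
    then obtain e where e: "e \<in> evec ` {1..n}" "e \<notin> pm_span B" by blast
    then have "\<not> pm_dependent (insert e B)" using B(2) by (intro pm.independent_insertI)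
    moreover have "insert e B \<subseteq> pm_span (evec ` {1..n})"
      using e(1) sub pm.span_base by blast
    ultimately have "card (insert e B) \<le> n" using card_le by blast
    moreover have "e \<notin> B" using e(2) pm.span_base by blast
    ultimately show False using card_le[OF B(2) sub] B(4) assms(2) by simp
  qed
  also have "\<dots> \<subseteq> pm_span (xvec ` C)" by (rule pm.span_mono[OF B(1)])
  finally show ?thesis .
qed

text \<open>Vectors indexed outside the window avoid the coordinates \<open>i\<close> to
  \<open>j\<close>, so they span at most \<open>n - (j - i + 1)\<close> dimensions; the window has
  to supply the rest of the rank.\<close>

lemma card_complement_ge:
  assumes "C \<subseteq> {1..2*n}" "pm_dim (xvec ` C :: 'a::field vector set) = n"
    and "1 \<le> i" "i \<le> j" "j \<le> n"
  shows "j - i + 1 \<le> card (C \<inter> {2 * i - 1..2 * j + 1})"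
proof -
  let ?J = "{2 * i - 1..2 * j + 1}"
  let ?W = "xvec ` (C \<inter> ?J) \<union> evec ` ({1..n} - {i..j}) :: 'a vector set"
  have fin: "finite C" using assms(1) finite_subset by blast
  have "xvec k \<in> pm_span ?W" if "k \<in> C" for k
  proof (cases "k \<in> ?J")
    case True
    with that show ?thesis by (intro pm.span_base) auto
  next
    case False
    have "(xvec k :: 'a vector) \<in> pm_span (evec ` ({1..n} - {i..j}))"
    proof (rule pm_span_evec)
      show "Poly_Mapping.keys (xvec k :: 'a vector) \<subseteq> {1..n} - {i..j}"
      proof
        fix l assume l: "l \<in> Poly_Mapping.keys (xvec k :: 'a vector)"
        then have "l \<in> {1..n}" using keys_xvec_le that assms(1) by blast
        then show "l \<in> {1..n} - {i..j}" using keys_xvec[OF l] False by auto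
      qed
    qed simp
    then show ?thesis using pm.span_mono[of "evec ` ({1..n} - {i..j})" ?W] by blast
  qed
  then have "n \<le> card ?W"
    using pm.dim_le_card[of "xvec ` C" ?W] assms(2) fin by auto
  also have "\<dots> \<le> card (xvec ` (C \<inter> ?J) :: 'a vector set) + card (evec ` ({1..n} - {i..j}) :: 'a vector set)"
    by (rule card_Un_le)
  also have "\<dots> \<le> card (C \<inter> ?J) + card ({1..n} - {i..j})"
    using fin by (intro add_mono card_image_le) auto
  also have "card ({1..n} - {i..j}) = n - (j - i + 1)"
    using assms by (subst card_Diff_subset) auto
  finally show ?thesis using assms by linarith
qed

section \<open>Exponents of the generators of the central space\<close>

lemma keys_central_generator:
  assumes R: "R \<subseteq> {1..2*n}" and dim: "pm_dim (xvec ` ({1..2*n} - R) :: 'a::field vector set) = n"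
  shows "Poly_Mapping.keys (\<Prod>k\<in>R. linear_form (xvec k) :: 'a mpoly) \<subseteq> S_BW n"
proof
  fix m assume m: "m \<in> Poly_Mapping.keys (\<Prod>k\<in>R. linear_form (xvec k) :: 'a mpoly)"
  have fin: "finite R" using R finite_subset by blast
  show "m \<in> S_BW n"
  proof (rule S_BW_I)
    have "Poly_Mapping.keys (linear_form (xvec k) :: 'a mpoly) \<subseteq> exponents n" if "k \<in> R" for k
      using that R keys_linear_form[of "xvec k :: 'a vector"] keys_xvec_le[of k n, where 'a = 'a]
      by (fastforce simp: exponents_def)
    with m show "m \<in> exponents n" using keys_prod_exponents[OF fin, of "\<lambda>k. linear_form (xvec k) :: 'a mpoly" n] by blast
  next
    fix i j assume ij: "1 \<le> i" "i \<le> j" "j \<le> n"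
    let ?J = "{2 * i - 1..2 * j + 1}"
    \<comment> \<open>Each factor is linear, so it adds at most 1 to the degree in these variables,
      and only if its index lies in the window.\<close>
    have "(\<Sum>l\<in>{i..j}. Poly_Mapping.lookup m l) \<le> (\<Sum>k\<in>R. of_bool (k \<in> ?J))"
    proof (rule keys_prod_weight_le[OF fin _ m])
      fix k m' assume "k \<in> R" "m' \<in> Poly_Mapping.keys (linear_form (xvec k) :: 'a mpoly)"
      then obtain l where l: "m' = Poly_Mapping.single l 1" "l \<in> Poly_Mapping.keys (xvec k :: 'a vector)"
        using keys_linear_form[of "xvec k :: 'a vector"] by blast
      have "k \<in> ?J" if "l \<in> {i..j}"
        using keys_xvec(2)[OF l(2)] that by auto
      then show "(\<Sum>l\<in>{i..j}. Poly_Mapping.lookup m' l) \<le> of_bool (k \<in> ?J)"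
        by (auto simp: l(1) lookup_single when_def)
    qed
    also have "\<dots> = card (R \<inter> ?J)"
      using fin by (simp add: Int_def)
    also have "\<dots> \<le> j - i + 1 + of_bool (j < n)"
    proof -
      have "j - i + 1 \<le> card (({1..2*n} - R) \<inter> ?J)"
        by (rule card_complement_ge) (use dim ij in auto)
      moreover have "card (R \<inter> ?J) + card (({1..2*n} - R) \<inter> ?J) = card ({1..2*n} \<inter> ?J)"
        using R fin by (subst card_Un_disjoint[symmetric]) (auto simp flip: Int_Un_distrib2 simp: Un_absorb1)
      \<comment> \<open>For \<open>j = n\<close> the last index \<open>2 * j + 1\<close> of the
        window falls outside the family.\<close>
      moreover have "{1..2*n} \<inter> ?J = {2 * i - 1..2 * j + of_bool (j < n)}"
        using ij by auto
      then have "card ({1..2*n} \<inter> ?J) = 2 * (j - i + 1) + of_bool (j < n)"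
        using ij by (cases "j < n") (simp_all only: card_atLeastAtMost of_bool_eq, arith+)
      moreover have "a \<le> d + e" if "d \<le> c" "a + c = b" "b = 2 * d + e" for a b c d e :: nat
        using that by linarith
      ultimately show ?thesis by blast
    qed
    finally show "(\<Sum>k\<in>{i..j}. Poly_Mapping.lookup m k) \<le> j - i + 1 + of_bool (j < n)" .
  qed
qed

section \<open>Passing from \<open>n\<close> to \<open>n + 1\<close> in the central space\<close>

lemma mult_P_central_Suc:
  fixes f :: "'a::field mpoly"
  assumes T: "T = {} \<or> T = {Suc (2 * n)} \<or> T = {2 * Suc n}" and f: "f \<in> P_central n"
  shows "(\<Prod>k\<in>T. linear_form (xvec k)) * f \<in> P_central (Suc n)"
proof -
  let ?p = "\<lambda>R. \<Prod>k\<in>R. linear_form (xvec k) :: 'a mpoly"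
  let ?G = "\<lambda>n. {?p R | R. R \<subseteq> {1..2*n} \<and> pm_dim (xvec ` ({1..2*n} - R) :: 'a vector set) = n}"
  have gen: "?p T * g \<in> pm_span (?G (Suc n))" if g: "g \<in> ?G n" for g
  proof -
    obtain R where R: "R \<subseteq> {1..2*n}" "pm_dim (xvec ` ({1..2*n} - R) :: 'a vector set) = n" "g = ?p R"
      using g by blast
    let ?C = "{1..2 * Suc n} - (T \<union> R)"
    have "evec ` {1..n} \<subseteq> pm_span (xvec ` ({1..2*n} - R) :: 'a vector set)"
      using R(2) by (rule evec_subset_span_xvec[OF Diff_subset])
    also have "\<dots> \<subseteq> pm_span (xvec ` ?C)"
      using T by (intro pm.span_mono image_mono) auto
    \<comment> \<open>The index 0 is included so that \<open>evec n\<close> below is covered for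
      \<open>n = 0\<close> as well.\<close>
    finally have old: "(evec i :: 'a vector) \<in> pm_span (xvec ` ?C)" if "i \<le> n" for i
      using that by (cases "i = 0") (auto simp: evec_def pm.span_zero[simplified])
    \<comment> \<open>At most one of the two new vectors is moved into the product. The other stays
      in the complement and yields the new unit vector, directly or after adding
      \<open>evec n\<close>.\<close>
    have "(evec (Suc n) :: 'a vector) \<in> pm_span (xvec ` ?C)"
    proof (cases "T = {2 * Suc n}")
      case True
      then have "(xvec (Suc (2 * n)) :: 'a vector) \<in> pm_span (xvec ` ?C)"
        using R(1) by (intro pm.span_base imageI) auto
      then have "(xvec (Suc (2 * n)) :: 'a vector) + evec n \<in> pm_span (xvec ` ?C)"
        using old by (intro pm.span_add) auto
      then show ?thesis by (simp only: xvec_odd diff_add_cancel)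
    next
      case False
      then have "(xvec (2 * Suc n) :: 'a vector) \<in> pm_span (xvec ` ?C)"
        using R(1) T by (intro pm.span_base imageI) auto
      then show ?thesis by (simp only: xvec_even)
    qed
    then have "evec ` {1..Suc n} \<subseteq> pm_span (xvec ` ?C :: 'a vector set)"
      using old by (auto simp: le_Suc_eq)
    then have "pm_dim (xvec ` ?C :: 'a vector set) = Suc n"
      by (intro pm_dim_xvec_eqI) auto
    moreover have "T \<union> R \<subseteq> {1..2 * Suc n}" using R(1) T by auto
    \<comment> \<open>The indices in \<open>T\<close> exceed \<open>2 * n\<close>, so they are
      disjoint from \<open>R\<close>.\<close>
    moreover have "?p T * g = ?p (T \<union> R)"
      using R T finite_subset[OF R(1)] by (subst prod.union_disjoint) auto
    ultimately show ?thesis by (intro pm.span_base) blast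
  qed
  have "f \<in> pm_span (?G n)" using f by (simp add: P_central_def)
  \<comment> \<open>Multiplication by a fixed polynomial is linear, so the case of generators
    extends to the span.\<close>
  then have "?p T * f \<in> pm_span (?G (Suc n))"
  proof (induction rule: pm.span_induct_alt)
    case base
    show ?case by (simp add: pm.span_zero)
  next
    case (step c x y)
    have "?p T * (pm_scale c x + y) = pm_scale c (?p T * x) + ?p T * y"
      by (simp add: pm_scale_def mult_map_scale_conv_mult algebra_simps)
    with step gen show ?case by (auto intro!: pm.span_add pm.span_scale)
  qed
  then show ?thesis by (simp add: P_central_def)
qed

lemma P_central_Suc:
  fixes f :: "'a::field mpoly"
  assumes "f \<in> P_central n"
  shows "f \<in> P_central (Suc n)" "tvar (Suc n) * f \<in> P_central (Suc n)"
    "n \<ge> 1 \<Longrightarrow> tvar n * f \<in> P_central (Suc n)"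
proof -
  show "f \<in> P_central (Suc n)" using mult_P_central_Suc[of "{}" n f] assms by simp
  have e: "tvar (Suc n) * f \<in> P_central (Suc n)"
    using mult_P_central_Suc[of "{2 * Suc n}" n f] assms
    by (simp add: xvec_even linear_form_evec del: mult_Suc_right)
  then show "tvar (Suc n) * f \<in> P_central (Suc n)" .
  assume n: "n \<ge> 1"
  have "(tvar (Suc n) - tvar n) * f \<in> P_central (Suc n)"
    using mult_P_central_Suc[of "{Suc (2 * n)}" n f] assms n
    by (simp add: linear_form_xvec_odd linear_form_evec)
  with e have "tvar (Suc n) * f - (tvar (Suc n) - tvar n) * f \<in> P_central (Suc n)"
    unfolding P_central_def by (rule pm.span_diff)
  then show "tvar n * f \<in> P_central (Suc n)" by (simp add: algebra_simps)
qed

lemma mon_add_single: "mon (s + Poly_Mapping.single i 1) = (tvar i * mon s :: 'a::field mpoly)"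
  by (simp add: tvar_def mult_single add.commute)

lemma mon_in_P_central: "s \<in> S_BW n \<Longrightarrow> (mon s :: 'a::field mpoly) \<in> P_central n"
proof (induction n arbitrary: s)
  case 0
  \<comment> \<open>The induction can start at 0: the only monomial is 1, which is the empty
    product, and the empty family has rank 0.\<close>
  then have "s = 0" by (simp add: S_BW_def exponents_def)
  moreover have "pm_dim ({} :: 'a vector set) = 0"
    using pm.dim_eq_card_independent[of "{} :: 'a vector set"] pm.independent_empty by simp
  ultimately show ?case
    unfolding P_central_def by (intro pm.span_base) (auto intro!: exI[of _ "{}"])
next
  case (Suc n)
  from Suc.prems show ?case
  proof (cases rule: S_BW_Suc_cases)
    case (1 s')
    show ?thesis unfolding 1(2) mon_add_single by (intro P_central_Suc(2) Suc.IH 1(1))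
  next
    case 2
    then show ?thesis using Suc.IH P_central_Suc(1) by blast
  next
    case (3 s')
    show ?thesis unfolding 3(3) mon_add_single by (intro P_central_Suc(3) Suc.IH 3(1,2))
  qed
qed

lemma P_central_eq: "P_central n = {p :: 'a::field mpoly. Poly_Mapping.keys p \<subseteq> S_BW n}"
proof
  show "P_central n \<subseteq> {p :: 'a mpoly. Poly_Mapping.keys p \<subseteq> S_BW n}"
    unfolding P_central_def using keys_central_generator[of _ n, where 'a = 'a]
    by (intro pm.span_minimal) (auto simp: pm_subspace_keys)
  have "pm_span (mon ` S_BW n) \<subseteq> (P_central n :: 'a mpoly set)"
    using mon_in_P_central[of _ n, where 'a = 'a]
    by (intro pm.span_minimal) (auto simp: P_central_def)
  then show "{p :: 'a mpoly. Poly_Mapping.keys p \<subseteq> S_BW n} \<subseteq> P_central n"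
    by (simp only: pm_span_mon)
qed

theorem theorem4:
  fixes n :: nat
  assumes "n \<ge> 1"
  shows "monomial_space n (P_central n :: 'a::field_char_0 mpoly set)
    \<and> monomial_space n (P_internal n :: 'a mpoly set)
    \<and> is_basis_of (tmon n ` S_BW n) (P_central n :: 'a mpoly set)
    \<and> inj_on (tmon n :: _ \<Rightarrow> 'a mpoly) (S_BW n)
    \<and> is_basis_of (tmon n ` squarefree_exponents n) (P_internal n :: 'a mpoly set)
    \<and> inj_on (tmon n :: _ \<Rightarrow> 'a mpoly) (squarefree_exponents n)"
proof -
  have "S_BW n \<subseteq> exponents n" by (auto simp: S_BW_def)
  moreover have "squarefree_exponents n \<subseteq> exponents n"
    by (auto simp: squarefree_exponents_def exponents_def)
  ultimately show ?thesis
    using monomial_basis[OF _ P_central_eq[of n, where 'a = 'a]]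
      monomial_basis[OF _ P_internal_eq[OF assms, where 'a = 'a]] by blast
qed

end
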